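(* Let $(X,\rho)$ be a compact metric space, let $d\ge 1$, let $T:\mathbb{Z}^d\times X\to X$ be a continuous $\mathbb{Z}^d$-action on $X$, and let $k\in\{1,\dots,2^d\}$. Then $(X,T)$ is $k$-type weakly mixing if and only if the induced action $(Sub_X,\hat{T})$ on the hyperspace $Sub_X$ is $k$-type weakly mixing.
   Context: A $\mathbb{Z}^d$-action on $X$ is a continuous map $T:\mathbb{Z}^d\times X\to X$, written $T^n(x)=T(n,x)$, with $T^0(x)=x$ and $T^{n+m}(x)=T^n(T^m(x))$ for all $x\in X$, $n,m\in\mathbb{Z}^d$. For $k\in\{1,\dots,2^d\}$ let $k^b=(k^b_1,\dots,k^b_d)\in\{0,1\}^d$ be defined by $k-1=\sum_{i=1}^d k^b_i 2^{i-1}$. For $x,y\in\mathbb{Z}^d$, write $x\ge^k y$ if $(-1)^{k^b_i}x_i\ge(-1)^{k^b_i}y_i$ for all $i=1,\dots,d$. The hyperspace $Sub_X$ is the set of all non-empty closed (equivalently, non-empty compact) subsets of $X$, endowed with the Hausdorff metric $H(A,B)=\max\{\sup_{a\in A}\rho(a,B),\sup_{b\in B}\rho(b,A)\}$, where $\rho(x,S)=\inf_{s\in S}\rho(x,s)$; it is a compact metric space. The induced $\mathbb{Z}^d$-action $\hat{T}$ on $Sub_X$ is $\hat{T}^m(A)=T^m(A)=\{T^m(x):x\in A\}$. A $\mathbb{Z}^d$-action $T$ on a space $X$ is $k$-type weakly mixing if the product action $T\times T$ on $X\times X$ is $k$-type transitive; equivalently, for any four non-empty open sets $U_1,U_2,V_1,V_2\subseteq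 X$ there is $m\in\mathbb{Z}^d$ with $m\ge^k 0$ such that $T^m(U_1)\cap V_1\neq\emptyset$ and $T^m(U_2)\cap V_2\ne\emptyset$. (An action is $k$-type transitive if for any non-empty open $U,V$ there is $m\ge^k 0$ with $T^m(U)\cap V\neq\emptyset$.) The same definitions apply to $(Sub_X,\hat{T})$. *)

theory Defs
  imports "HOL-Analysis.Analysis"
begin

section \<open>The group of integer vectors and the orthant orders\<close>

text \<open>
  Vectors are extensional functions on \<open>{1..d}\<close>, because the orders below depend on the
  numbering of the coordinates, which a finite index type does not provide.
\<close>

definition zvec :: "nat \<Rightarrow> (nat \<Rightarrow> int) set"
  where "zvec d = ({1..d} \<rightarrow>\<^sub>E UNIV)"

definition zvec_zero :: "nat \<Rightarrow> nat \<Rightarrow> int"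
  where "zvec_zero d = (\<lambda>i\<in>{1..d}. 0)"

definition zvec_add :: "nat \<Rightarrow> (nat \<Rightarrow> int) \<Rightarrow> (nat \<Rightarrow> int) \<Rightarrow> nat \<Rightarrow> int"
  where "zvec_add d n m = (\<lambda>i\<in>{1..d}. n i + m i)"

text \<open>The digits are numbered from 1, and \<open>k\<close> encodes the digit string of \<open>k - 1\<close>.\<close>

definition kbit :: "nat \<Rightarrow> nat \<Rightarrow> nat"
  where "kbit k i = (k - 1) div 2 ^ (i - 1) mod 2"

definition ge_type :: "nat \<Rightarrow> nat \<Rightarrow> (nat \<Rightarrow> int) \<Rightarrow> (nat \<Rightarrow> int) \<Rightarrow> bool"
  where "ge_type d k x y \<longleftrightarrow>
    (\<forall>i\<in>{1..d}. (- 1) ^ kbit k i * x i \<ge> (- 1) ^ kbit k i * y i)"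

lemma kbit_expansion:
  assumes "k \<in> {1..2 ^ d}"
  shows "k - 1 = (\<Sum>i = 1..d. kbit k i * 2 ^ (i - 1))"
proof -
  have *: "n mod 2 ^ d = (\<Sum>i = 1..d. (n div 2 ^ (i - 1) mod 2) * 2 ^ (i - 1))" for n :: nat
  proof (induction d)
    case (Suc d)
    have "n mod 2 ^ Suc d = n mod 2 ^ d + (n div 2 ^ d mod 2) * 2 ^ d"
      using mod_mult2_eq[of n "2 ^ d" 2] by (simp add: mult.commute)
    then show ?case using Suc by simp
  qed simp
  from assms have "k - 1 < 2 ^ d" by auto
  then have "k - 1 = (k - 1) mod 2 ^ d" by simp
  then show ?thesis unfolding kbit_def using *[of "k - 1"] by simp
qed

lemma kbit_unique:
  assumes "\<forall>i\<in>{1..d}. b i \<in> {0, 1}" and "k \<ge> 1"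
    and "k - 1 = (\<Sum>i = 1..d. b i * 2 ^ (i - 1))" and "i \<in> {1..d}"
  shows "b i = kbit k i"
proof -
  have "(\<Sum>i = 1..d. b i * 2 ^ (i - 1)) div 2 ^ (j - 1) mod 2 = b j"
    if "\<forall>i\<in>{1..d}. b i \<in> {0, 1}" "j \<in> {1..d}" for b :: "nat \<Rightarrow> nat" and j
    using that
  proof (induction d arbitrary: b j)
    case (Suc d)
    let ?c = "\<lambda>i. b (Suc i)"
    have split: "(\<Sum>i = 1..Suc d. b i * 2 ^ (i - 1))
        = b 1 + 2 * (\<Sum>i = 1..d. ?c i * 2 ^ (i - 1))"
    proof -
      have "(\<Sum>i = 1..Suc d. b i * 2 ^ (i - 1)) = b 1 + (\<Sum>i = Suc 1..Suc d. b i * 2 ^ (i - 1))"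
        by (subst sum.atLeast_Suc_atMost) auto
      also have "(\<Sum>i = Suc 1..Suc d. b i * 2 ^ (i - 1)) = (\<Sum>i = 1..d. b (Suc i) * 2 ^ i)"
        by (subst sum.shift_bounds_cl_Suc_ivl) simp
      also have "\<dots> = (\<Sum>i = 1..d. 2 * (?c i * 2 ^ (i - 1)))"
        by (intro sum.cong refl) (auto simp: power_eq_if)
      finally show ?thesis by (simp add: sum_distrib_left)
    qed
    have b1: "b 1 \<in> {0, 1}" using Suc.prems by auto
    show ?case
    proof (cases "j = 1")
      case True
      with b1 show ?thesis unfolding split by auto
    next
      case False
      then obtain l where l: "j = Suc l" "l \<in> {1..d}" using Suc.prems by (cases j) auto
      have "(b 1 + 2 * (\<Sum>i = 1..d. ?c i * 2 ^ (i - 1))) div 2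
          = (\<Sum>i = 1..d. ?c i * 2 ^ (i - 1))" using b1 by auto
      moreover have "(2::nat) ^ (j - 1) = 2 * 2 ^ (l - 1)" using l by (auto simp: power_eq_if)
      moreover have "(\<Sum>i = 1..d. ?c i * 2 ^ (i - 1)) div 2 ^ (l - 1) mod 2 = ?c l"
        using Suc.IH[of ?c l] Suc.prems l by auto
      ultimately show ?thesis unfolding split by (simp add: div_mult2_eq l)
    qed
  qed simp
  from this[OF assms(1,4)] show ?thesis using assms(3) unfolding kbit_def by simp
qed


section \<open>Actions, transitivity and weak mixing of type k\<close>

definition zaction :: "nat \<Rightarrow> 'a topology \<Rightarrow> ((nat \<Rightarrow> int) \<Rightarrow> 'a \<Rightarrow> 'a) \<Rightarrow> bool"
  where "zaction d X T \<longleftrightarrow>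
    continuous_map (prod_topology (discrete_topology (zvec d)) X) X (\<lambda>(n, x). T n x) \<and>
    (\<forall>x\<in>topspace X. T (zvec_zero d) x = x) \<and>
    (\<forall>n\<in>zvec d. \<forall>m\<in>zvec d. \<forall>x\<in>topspace X. T (zvec_add d n m) x = T n (T m x))"

definition type_transitive ::
    "nat \<Rightarrow> nat \<Rightarrow> 'a topology \<Rightarrow> ((nat \<Rightarrow> int) \<Rightarrow> 'a \<Rightarrow> 'a) \<Rightarrow> bool"
  where "type_transitive d k X T \<longleftrightarrow>
    (\<forall>U V. openin X U \<and> U \<noteq> {} \<and> openin X V \<and> V \<noteq> {} \<longrightarrow>
      (\<exists>m\<in>zvec d. ge_type d k m (zvec_zero d) \<and> T m ` U \<inter> V \<noteq> {}))"

definition type_weakly_mixing ::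
    "nat \<Rightarrow> nat \<Rightarrow> 'a topology \<Rightarrow> ((nat \<Rightarrow> int) \<Rightarrow> 'a \<Rightarrow> 'a) \<Rightarrow> bool"
  where "type_weakly_mixing d k X T \<longleftrightarrow>
    type_transitive d k (prod_topology X X) (\<lambda>m. map_prod (T m) (T m))"


section \<open>The hyperspace with the Hausdorff metric\<close>

definition hyper_carrier :: "'a metric \<Rightarrow> 'a set set"
  where "hyper_carrier X = {A. closedin (mtopology_of X) A \<and> A \<noteq> {}}"

definition point_set_dist :: "'a metric \<Rightarrow> 'a \<Rightarrow> 'a set \<Rightarrow> real"
  where "point_set_dist X x S = (INF s\<in>S. mdist X x s)"

text \<open>
  The value 0 off the carrier is only there because the library's metrics must be
  non-negative on the whole type.
\<close>

definition hausdorff_dist :: "'a metric \<Rightarrow> 'a set \<Rightarrow> 'a set \<Rightarrow> real"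
  where "hausdorff_dist X A B =
    (if A \<in> hyper_carrier X \<and> B \<in> hyper_carrier X
     then max (SUP a\<in>A. point_set_dist X a B) (SUP b\<in>B. point_set_dist X b A)
     else 0)"

text \<open>
  Meaningful only if \<open>hausdorff_dist X\<close> is a metric on the carrier, as is the case for
  compact \<open>X\<close> (lemma \<open>Metric_space_hausdorff\<close>).
\<close>

definition hyperspace :: "'a metric \<Rightarrow> 'a set metric"
  where "hyperspace X = metric (hyper_carrier X, hausdorff_dist X)"

definition induced_action :: "((nat \<Rightarrow> int) \<Rightarrow> 'a \<Rightarrow> 'a) \<Rightarrow> (nat \<Rightarrow> int) \<Rightarrow> 'a set \<Rightarrow> 'a set"
  where "induced_action T m A = T m ` A"

lemma Metric_space_hausdorff:
  assumes "compact_space (mtopology_of X)"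
  shows "Metric_space (hyper_carrier X) (hausdorff_dist X)"
proof -
  interpret Metric_space "mspace X" "mdist X" by (rule Metric_space_mspace_mdist)
  let ?S = "hyper_carrier X"
  define P where "P = point_set_dist X"
  define E where "E = (\<lambda>A B. SUP a\<in>A. P a B)"
  have H: "hausdorff_dist X A B = max (E A B) (E B A)" if "A \<in> ?S" "B \<in> ?S" for A B
    using that by (simp add: hausdorff_dist_def E_def P_def)
  have top: "mtopology_of X = mtopology" by (simp add: mtopology_of_def)
  have sub: "A \<subseteq> mspace X" "A \<noteq> {}" if "A \<in> ?S" for A
    using that closedin_subset[of "mtopology_of X" A] by (auto simp: hyper_carrier_def)
  have "mbounded (mspace X)"
    using assms compactin_imp_mbounded by (simp add: compact_space_def mtopology_of_def)
  then obtain C where C: "\<And>x y. x \<in> mspace X \<Longrightarrow> y \<in> mspace X \<Longrightarrow> mdist X x y \<le> C"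
    unfolding mbounded_alt by blast
  have bdd: "bdd_below ((\<lambda>s. mdist X x s) ` B)" for x B
    by (rule bdd_belowI[of _ 0]) auto
  have P_le: "P a B \<le> mdist X a b" if "b \<in> B" for a b B
    unfolding P_def point_set_dist_def using that by (intro cINF_lower bdd)
  have P_ge: "c \<le> P a B" if "B \<noteq> {}" "\<And>b. b \<in> B \<Longrightarrow> c \<le> mdist X a b" for a B c
    unfolding P_def point_set_dist_def using that by (intro cINF_greatest)
  have E_ge: "P a B \<le> E A B" if "A \<in> ?S" "B \<in> ?S" "a \<in> A" for a A B
  proof -
    have ne: "A \<subseteq> mspace X" "B \<subseteq> mspace X" "B \<noteq> {}" using sub that by auto
    have "bdd_above ((\<lambda>a. P a B) ` A)"
    proof (rule bdd_aboveI[of _ C])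
      fix t assume "t \<in> (\<lambda>a. P a B) ` A"
      then obtain a where a: "a \<in> A" "t = P a B" by auto
      obtain b where b: "b \<in> B" using ne by blast
      then have "mdist X a b \<le> C" using a ne by (intro C) auto
      then show "t \<le> C" using a P_le[OF b, of a] by linarith
    qed
    then show ?thesis unfolding E_def using that(3) by (rule cSUP_upper2) simp
  qed
  have E_le: "E A B \<le> c" if "A \<noteq> {}" "\<And>a. a \<in> A \<Longrightarrow> P a B \<le> c" for A B c
    unfolding E_def using that by (intro cSUP_least)
  have P_nn: "0 \<le> P a B" if "B \<in> ?S" for a B using sub that by (intro P_ge) auto
  have E_nn: "0 \<le> E A B" if "A \<in> ?S" "B \<in> ?S" for A B
  proof -
    have "A \<noteq> {}" using sub that by blast
    then obtain a where "a \<in> A" by blast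
    then show ?thesis using E_ge[of A B a] P_nn[of B a] that by linarith
  qed
  have tri: "E A D \<le> E A B + E B D" if "A \<in> ?S" "B \<in> ?S" "D \<in> ?S" for A B D
  proof (rule E_le)
    show "A \<noteq> {}" using sub that by blast
    fix a assume a: "a \<in> A"
    have "P a D - E B D \<le> P a B"
    proof (rule P_ge)
      show "B \<noteq> {}" using sub that by blast
      fix b assume b: "b \<in> B"
      have "P a D - mdist X a b \<le> P b D"
      proof (rule P_ge)
        show "D \<noteq> {}" using sub that by blast
        fix e assume e: "e \<in> D"
        have "mdist X a e \<le> mdist X a b + mdist X b e"
          using a b e sub that by (intro triangle) blast+
        then show "P a D - mdist X a b \<le> mdist X b e" using P_le[OF e, of a] by linarith
      qed
      then show "P a D - E B D \<le> mdist X a b" using E_ge[of B D b] b that by linarith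
    qed
    then show "P a D \<le> E A B + E B D" using E_ge[of A B a] a that by linarith
  qed
  have incl: "A \<subseteq> B" if "A \<in> ?S" "B \<in> ?S" "E A B \<le> 0" for A B
  proof
    fix a assume a: "a \<in> A"
    have "\<exists>b\<in>B. mdist X a b < r" if "r > 0" for r
    proof (rule ccontr)
      assume "\<not> ?thesis"
      then have "r \<le> P a B" using sub(2)[OF \<open>B \<in> ?S\<close>] by (intro P_ge) (auto simp: not_less)
      then show False using E_ge[of A B a] a \<open>r > 0\<close> \<open>A \<in> ?S\<close> \<open>B \<in> ?S\<close> \<open>E A B \<le> 0\<close> by linarith
    qed
    moreover have "a \<in> mspace X" "B \<subseteq> mspace X" using a sub that by auto
    ultimately have "a \<in> mtopology closure_of B"
      unfolding metric_closure_of by (auto simp: subset_iff)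
    then show "a \<in> B"
      using that(2) closure_of_closedin[of mtopology B] by (simp add: hyper_carrier_def top)
  qed
  show ?thesis
  proof
    show "0 \<le> hausdorff_dist X A B" for A B
      using H E_nn by (cases "A \<in> ?S \<and> B \<in> ?S") (auto simp: hausdorff_dist_def le_max_iff_disj)
    show "hausdorff_dist X A B = hausdorff_dist X B A" for A B
      by (simp add: hausdorff_dist_def max.commute)
    show "hausdorff_dist X A B = 0 \<longleftrightarrow> A = B" if "A \<in> ?S" "B \<in> ?S" for A B
    proof
      assume "hausdorff_dist X A B = 0"
      then have "E A B \<le> 0" "E B A \<le> 0" using H that by (auto simp: max_def split: if_splits)
      then show "A = B" using incl that by blast
    next
      assume "A = B"
      have "E A A \<le> 0"
      proof (rule E_le)
        show "A \<noteq> {}" using sub that by blast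
        show "P a A \<le> 0" if "a \<in> A" for a
          using P_le[OF that, of a] mdist_zero[of a] that sub(1)[OF \<open>A \<in> ?S\<close>] by force
      qed
      then show "hausdorff_dist X A B = 0" using H E_nn \<open>A = B\<close> that by (simp add: antisym)
    qed
    show "hausdorff_dist X A D \<le> hausdorff_dist X A B + hausdorff_dist X B D"
      if "A \<in> ?S" "B \<in> ?S" "D \<in> ?S" for A B D
      using H that tri[of A B D] tri[of D B A] by (auto simp: max_def)
  qed
qed

lemma hyperspace_simps:
  assumes "compact_space (mtopology_of X)"
  shows "mspace (hyperspace X) = hyper_carrier X" "mdist (hyperspace X) = hausdorff_dist X"
  using Metric_space_hausdorff[OF assms]
  by (simp_all add: hyperspace_def Metric_space.mspace_metric Metric_space.mdist_metric)

end

theory Submission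
  imports Defs
begin

text \<open>
  Weak mixing says that any two sets of hitting times \<open>{m \<ge>\<^sup>k 0. T\<^sup>m U \<inter> V \<noteq> \<emptyset>}\<close>, for
  non-empty open \<open>U\<close> and \<open>V\<close>, have a common element. Because the acting group is abelian,
  Furstenberg's argument makes these sets a filter base (\<open>hitting_subset_Int\<close>), so that even
  finitely many of them have a common element (\<open>INT_hitting_nonempty\<close>).

  From the base to the hyperspace: a non-empty open set of closed sets comes with finitely many
  non-empty open subsets of \<open>X\<close> such that every finite set which lies in their union and meets
  each of them is a member (\<open>hyperspace_open_finite_family\<close>). Suppose that \<open>F\<close> and \<open>G\<close> are such
  families for a source and a target. A time \<open>m\<close> that moves some point \<open>x\<^sub>u\<^sub>v\<close> of \<open>u\<close> into \<open>v\<close>,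
  for all \<open>u \<in> F\<close> and \<open>v \<in> G\<close> at once, moves the finite set of the points \<open>x\<^sub>u\<^sub>v\<close> from the source
  into the target. Taking all pairs makes it irrelevant whether \<open>F\<close> and \<open>G\<close> have equally many
  members. Two sources and two targets only need a larger finite set of pairs.

  From the hyperspace to the base: all members of a Hausdorff ball around \<open>{x}\<close> are contained in
  the ball around \<open>x\<close> of the same radius (\<open>subset_mball_if_hausdorff_dist_less\<close>), so a time that
  works for Hausdorff balls around singletons works for the balls around their points.
\<close>

section \<open>Hitting times\<close>

definition hitting ::
    "nat \<Rightarrow> nat \<Rightarrow> ((nat \<Rightarrow> int) \<Rightarrow> 'a \<Rightarrow> 'a) \<Rightarrow> 'a set \<Rightarrow> 'a set \<Rightarrow> (nat \<Rightarrow> int) set"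
  where "hitting d k T U V =
    {m \<in> zvec d. ge_type d k m (zvec_zero d) \<and> T m ` U \<inter> V \<noteq> {}}"

lemma hitting_mono:
  "U \<subseteq> U' \<Longrightarrow> V \<subseteq> V' \<Longrightarrow> hitting d k T U V \<subseteq> hitting d k T U' V'"
  unfolding hitting_def by blast

lemma type_transitive_iff_hitting:
  "type_transitive d k X T \<longleftrightarrow>
    (\<forall>U V. openin X U \<and> U \<noteq> {} \<and> openin X V \<and> V \<noteq> {} \<longrightarrow> hitting d k T U V \<noteq> {})"
  by (simp add: type_transitive_def hitting_def Bex_def conj_left_commute)

lemma hitting_Times:
  "hitting d k (\<lambda>m. map_prod (T m) (T m)) (U1 \<times> U2) (V1 \<times> V2) =
    hitting d k T U1 V1 \<inter> hitting d k T U2 V2"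
proof -
  have "map_prod (T m) (T m) ` (U1 \<times> U2) \<inter> V1 \<times> V2 = (T m ` U1 \<inter> V1) \<times> (T m ` U2 \<inter> V2)" for m
    by (auto simp: map_prod_def)
  then show ?thesis unfolding hitting_def by auto
qed

lemma openin_prod_topology_nonempty_box:
  assumes "openin (prod_topology X Y) W" "W \<noteq> {}"
  obtains U V where "openin X U" "U \<noteq> {}" "openin Y V" "V \<noteq> {}" "U \<times> V \<subseteq> W"
proof -
  obtain x y where "(x, y) \<in> W" using assms(2) by auto
  then have "\<exists>U V. openin X U \<and> openin Y V \<and> x \<in> U \<and> y \<in> V \<and> U \<times> V \<subseteq> W"
    using assms(1)[unfolded openin_prod_topology_alt] by simp
  then show thesis using that by fast
qed

lemma type_weakly_mixing_iff_hitting: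
  "type_weakly_mixing d k X T \<longleftrightarrow>
    (\<forall>U1 U2 V1 V2. openin X U1 \<and> U1 \<noteq> {} \<and> openin X U2 \<and> U2 \<noteq> {} \<and>
      openin X V1 \<and> V1 \<noteq> {} \<and> openin X V2 \<and> V2 \<noteq> {} \<longrightarrow>
      hitting d k T U1 V1 \<inter> hitting d k T U2 V2 \<noteq> {})"
    (is "?L \<longleftrightarrow> ?R")
proof
  assume L: ?L
  show ?R
  proof (intro allI impI)
    fix U1 U2 V1 V2
    assume *: "openin X U1 \<and> U1 \<noteq> {} \<and> openin X U2 \<and> U2 \<noteq> {} \<and>
      openin X V1 \<and> V1 \<noteq> {} \<and> openin X V2 \<and> V2 \<noteq> {}"
    then have "openin (prod_topology X X) (U1 \<times> U2)" "openin (prod_topology X X) (V1 \<times> V2)"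
      by (simp_all add: openin_prod_Times_iff)
    then have "hitting d k (\<lambda>m. map_prod (T m) (T m)) (U1 \<times> U2) (V1 \<times> V2) \<noteq> {}"
      using L * unfolding type_weakly_mixing_def type_transitive_iff_hitting
      by (metis Times_empty)
    then show "hitting d k T U1 V1 \<inter> hitting d k T U2 V2 \<noteq> {}"
      unfolding hitting_Times .
  qed
next
  assume R: ?R
  show ?L
    unfolding type_weakly_mixing_def type_transitive_iff_hitting
  proof (intro allI impI)
    fix U V
    assume *: "openin (prod_topology X X) U \<and> U \<noteq> {} \<and> openin (prod_topology X X) V \<and> V \<noteq> {}"
    obtain U1 U2 where U: "openin X U1" "U1 \<noteq> {}" "openin X U2" "U2 \<noteq> {}" "U1 \<times> U2 \<subseteq> U"
      using * openin_prod_topology_nonempty_box by metis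
    obtain V1 V2 where V: "openin X V1" "V1 \<noteq> {}" "openin X V2" "V2 \<noteq> {}" "V1 \<times> V2 \<subseteq> V"
      using * openin_prod_topology_nonempty_box by metis
    have "hitting d k (\<lambda>m. map_prod (T m) (T m)) (U1 \<times> U2) (V1 \<times> V2) \<noteq> {}"
      unfolding hitting_Times using R U V by blast
    then show "hitting d k (\<lambda>m. map_prod (T m) (T m)) U V \<noteq> {}"
      using hitting_mono[OF U(5) V(5)] by blast
  qed
qed


section \<open>Common hitting times of finitely many pairs\<close>

lemma zaction_continuous_map:
  assumes "zaction d X T" "m \<in> zvec d"
  shows "continuous_map X X (T m)"
proof -
  have "continuous_map X (prod_topology (discrete_topology (zvec d)) X) (\<lambda>x. (m, x))"
    using assms(2) by (intro continuous_map_pairedI) auto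
  then have "continuous_map X X ((\<lambda>(n, x). T n x) \<circ> (\<lambda>x. (m, x)))"
    by (rule continuous_map_compose) (use assms(1) in \<open>simp add: zaction_def\<close>)
  then show ?thesis by (simp add: o_def)
qed

lemma zaction_commute:
  assumes "zaction d X T" "n \<in> zvec d" "m \<in> zvec d" "x \<in> topspace X"
  shows "T n (T m x) = T m (T n x)"
proof -
  have "zvec_add d n m = zvec_add d m n"
    unfolding zvec_add_def by (simp add: add.commute)
  moreover have "T (zvec_add d n m) x = T n (T m x)" "T (zvec_add d m n) x = T m (T n x)"
    using assms unfolding zaction_def by blast+
  ultimately show ?thesis by simp
qed

text \<open>
  Furstenberg's intersection argument. Weak mixing gives one time \<open>m\<close> at which \<open>U1\<close> hits \<open>U2\<close>
  and \<open>V1\<close> hits \<open>V2\<close>; the points of \<open>U1\<close> and \<open>V1\<close> that do so form the new pair. If a point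
  \<open>x\<close> of the new \<open>U\<close> is moved by \<open>T\<^sup>n\<close> into the new \<open>V\<close>, then \<open>x\<close> shows that \<open>n\<close> is a hitting
  time for the first pair, and \<open>T\<^sup>m x\<close> shows it for the second, as \<open>T\<^sup>n\<close> and \<open>T\<^sup>m\<close> commute.
\<close>

lemma hitting_subset_Int:
  assumes T: "zaction d X T" and wm: "type_weakly_mixing d k X T"
    and U1: "openin X U1" "U1 \<noteq> {}" and V1: "openin X V1" "V1 \<noteq> {}"
    and U2: "openin X U2" "U2 \<noteq> {}" and V2: "openin X V2" "V2 \<noteq> {}"
  obtains U V where "openin X U" "U \<noteq> {}" "openin X V" "V \<noteq> {}"
    "hitting d k T U V \<subseteq> hitting d k T U1 V1 \<inter> hitting d k T U2 V2"
proof -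
  have "hitting d k T U1 U2 \<inter> hitting d k T V1 V2 \<noteq> {}"
    using wm U1 V1 U2 V2 unfolding type_weakly_mixing_iff_hitting by blast
  then obtain m where m: "m \<in> zvec d" "T m ` U1 \<inter> U2 \<noteq> {}" "T m ` V1 \<inter> V2 \<noteq> {}"
    unfolding hitting_def by blast
  define pre where "pre = (\<lambda>W. {x \<in> topspace X. T m x \<in> W})"
  have sub: "U1 \<subseteq> topspace X" "V1 \<subseteq> topspace X"
    using U1 V1 by (simp_all add: openin_subset)
  have pre: "openin X (pre W)" if "openin X W" for W
    using zaction_continuous_map[OF T m(1)] that unfolding pre_def
    by (rule openin_continuous_map_preimage)
  show thesis
  proof
    show "openin X (U1 \<inter> pre U2)" "openin X (V1 \<inter> pre V2)"
      using U1 U2 V1 V2 pre by blast+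
    show "U1 \<inter> pre U2 \<noteq> {}" "V1 \<inter> pre V2 \<noteq> {}"
      using m(2,3) sub unfolding pre_def by blast+
    show "hitting d k T (U1 \<inter> pre U2) (V1 \<inter> pre V2)
        \<subseteq> hitting d k T U1 V1 \<inter> hitting d k T U2 V2"
    proof
      fix n assume n: "n \<in> hitting d k T (U1 \<inter> pre U2) (V1 \<inter> pre V2)"
      then obtain x where x: "x \<in> U1" "x \<in> pre U2" "T n x \<in> V1" "T n x \<in> pre V2"
        unfolding hitting_def by blast
      have "T n (T m x) = T m (T n x)"
        using n x sub by (intro zaction_commute[OF T _ m(1)]) (auto simp: hitting_def)
      then have "T n (T m x) \<in> V2" using x unfolding pre_def by simp
      moreover have "T m x \<in> U2" using x unfolding pre_def by simp
      ultimately show "n \<in> hitting d k T U1 V1 \<inter> hitting d k T U2 V2"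
        using n x unfolding hitting_def by blast
    qed
  qed
qed

lemma INT_hitting_nonempty:
  assumes T: "zaction d X T" and wm: "type_weakly_mixing d k X T"
    and P: "finite P" "P \<noteq> {}"
    and nonempty_open: "\<And>U V. (U, V) \<in> P \<Longrightarrow> openin X U \<and> U \<noteq> {} \<and> openin X V \<and> V \<noteq> {}"
  shows "(\<Inter>(U, V)\<in>P. hitting d k T U V) \<noteq> {}"
proof -
  have "\<exists>U V. openin X U \<and> U \<noteq> {} \<and> openin X V \<and> V \<noteq> {} \<and>
      hitting d k T U V \<subseteq> (\<Inter>(U, V)\<in>P. hitting d k T U V)"
    using P nonempty_open
  proof (induction P rule: finite_ne_induct)
    case (singleton p)
    then show ?case by (cases p) auto
  next
    case (insert p P)
    obtain U1 V1 where p: "p = (U1, V1)" by (cases p)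
    have 1: "openin X U1" "U1 \<noteq> {}" "openin X V1" "V1 \<noteq> {}"
      using insert.prems[of U1 V1] p by auto
    obtain U2 V2 where 2: "openin X U2" "U2 \<noteq> {}" "openin X V2" "V2 \<noteq> {}"
      "hitting d k T U2 V2 \<subseteq> (\<Inter>(U, V)\<in>P. hitting d k T U V)"
      using insert.IH insert.prems by (metis insertCI)
    obtain U V where "openin X U" "U \<noteq> {}" "openin X V" "V \<noteq> {}"
      "hitting d k T U V \<subseteq> hitting d k T U1 V1 \<inter> hitting d k T U2 V2"
      by (rule hitting_subset_Int[OF T wm 1 2(1-4)])
    then show ?case using 2(5) p by (intro exI[of _ U] exI[of _ V]) auto
  qed
  then obtain U V where "openin X U" "U \<noteq> {}" "openin X V" "V \<noteq> {}"
    and sub: "hitting d k T U V \<subseteq> (\<Inter>(U, V)\<in>P. hitting d k T U V)"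
    by blast
  then have "hitting d k T U V \<noteq> {}"
    using wm unfolding type_weakly_mixing_iff_hitting by blast
  with sub show ?thesis by blast
qed


section \<open>Open sets of the hyperspace\<close>

lemma finite_in_hyper_carrier:
  assumes "finite C" "C \<noteq> {}" "C \<subseteq> mspace X"
  shows "C \<in> hyper_carrier X"
proof -
  have "Hausdorff_space (mtopology_of X)"
    unfolding mtopology_of_def
    by (simp add: Metric_space.Hausdorff_space_mtopology Metric_space_mspace_mdist)
  then show ?thesis
    using assms unfolding hyper_carrier_def
    by (simp add: closedin_Hausdorff_finite topspace_mtopology_of)
qed

lemma hyper_carrier_subset: "A \<in> hyper_carrier X \<Longrightarrow> A \<subseteq> mspace X"
  using closedin_subset[of "mtopology_of X" A] by (simp add: hyper_carrier_def)

lemma point_set_dist_le: "b \<in> B \<Longrightarrow> point_set_dist X a B \<le> mdist X a b"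
  unfolding point_set_dist_def by (intro cINF_lower bdd_belowI[of _ 0]) auto

lemma hausdorff_dist_leI:
  assumes "A \<in> hyper_carrier X" "B \<in> hyper_carrier X"
    and "\<And>a. a \<in> A \<Longrightarrow> \<exists>b\<in>B. mdist X a b \<le> r"
    and "\<And>b. b \<in> B \<Longrightarrow> \<exists>a\<in>A. mdist X b a \<le> r"
  shows "hausdorff_dist X A B \<le> r"
proof -
  have "A \<noteq> {}" "B \<noteq> {}" using assms unfolding hyper_carrier_def by auto
  moreover have "point_set_dist X a B \<le> r" if "a \<in> A" for a
    using assms(3)[OF that] point_set_dist_le order_trans by metis
  moreover have "point_set_dist X b A \<le> r" if "b \<in> B" for b
    using assms(4)[OF that] point_set_dist_le order_trans by metis
  ultimately show ?thesis
    using assms(1,2) by (simp add: hausdorff_dist_def cSUP_least)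
qed

text \<open>
  The distance from \<open>a \<in> A\<close> to the set \<open>{x}\<close> is the distance to \<open>x\<close>, and it is one of the values
  whose supremum enters the Hausdorff distance. Compactness makes these values bounded, so that
  the supremum dominates each of them.
\<close>

lemma subset_mball_if_hausdorff_dist_less:
  assumes "compact_space (mtopology_of X)"
    and A: "A \<in> hyper_carrier X" and x: "x \<in> mspace X" and H: "hausdorff_dist X {x} A < r"
  shows "A \<subseteq> mball_of X x r"
proof
  interpret M: Metric_space "mspace X" "mdist X" by (rule Metric_space_mspace_mdist)
  fix a assume a: "a \<in> A"
  have sub: "A \<subseteq> mspace X" using A by (rule hyper_carrier_subset)
  have "M.mbounded (mspace X)"
    using assms(1) M.compactin_imp_mbounded by (simp add: compact_space_def mtopology_of_def)
  then obtain C where C: "\<And>x y. x \<in> mspace X \<Longrightarrow> y \<in> mspace X \<Longrightarrow> mdist X x y \<le> C"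
    unfolding M.mbounded_alt by blast
  have "bdd_above ((\<lambda>b. mdist X b x) ` A)"
    using C sub x by (intro bdd_aboveI[of _ C]) auto
  then have "mdist X a x \<le> (SUP b\<in>A. mdist X b x)"
    using a by (rule cSUP_upper2) simp
  also have "\<dots> \<le> hausdorff_dist X {x} A"
    using A finite_in_hyper_carrier[of "{x}" X] x
    by (simp add: hausdorff_dist_def point_set_dist_def)
  finally show "a \<in> mball_of X x r"
    using H a sub x by (auto simp: mball_of_def M.in_mball mdist_commute)
qed

text \<open>
  The open set contains a Hausdorff ball around one of its members \<open>A\<close>, and the family consists
  of small balls around the points of a finite net in \<open>A\<close>. Meeting every one of them brings a set
  near all of \<open>A\<close>, and lying in their union keeps the set near \<open>A\<close>.
\<close>

lemma hyperspace_open_finite_family: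
  assumes cpt: "compact_space (mtopology_of X)"
    and \<U>: "openin (mtopology_of (hyperspace X)) \<U>" "\<U> \<noteq> {}"
  obtains F where "finite F" "F \<noteq> {}" "\<And>u. u \<in> F \<Longrightarrow> openin (mtopology_of X) u \<and> u \<noteq> {}"
    "\<And>C. finite C \<Longrightarrow> C \<subseteq> \<Union>F \<Longrightarrow> (\<And>u. u \<in> F \<Longrightarrow> C \<inter> u \<noteq> {}) \<Longrightarrow> C \<in> \<U>"
proof -
  interpret M: Metric_space "mspace X" "mdist X" by (rule Metric_space_mspace_mdist)
  interpret H: Metric_space "hyper_carrier X" "hausdorff_dist X"
    by (rule Metric_space_hausdorff[OF cpt])
  have topH: "mtopology_of (hyperspace X) = H.mtopology"
    by (simp add: mtopology_of_def hyperspace_simps[OF cpt])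
  have topX: "mtopology_of X = M.mtopology" by (simp add: mtopology_of_def)
  obtain A where A: "A \<in> \<U>" using \<U>(2) by blast
  then obtain r where r: "r > 0" "H.mball A r \<subseteq> \<U>" and AH: "A \<in> hyper_carrier X"
    using \<U>(1) unfolding topH H.openin_mtopology by blast
  have Asub: "A \<subseteq> mspace X" and Ane: "A \<noteq> {}"
    using AH hyper_carrier_subset by (auto simp: hyper_carrier_def)
  have "compactin M.mtopology A"
    using cpt AH closedin_compact_space unfolding hyper_carrier_def topX by blast
  then have "M.mtotally_bounded A" by (rule M.compactin_imp_mtotally_bounded)
  \<comment> \<open>Two points of a ball of radius \<open>r / 4\<close> are within \<open>r / 2\<close>. This leaves room below \<open>r\<close>,
    which is needed because pointwise strict bounds become weak for the supremum.\<close>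
  then obtain K where K: "finite K" "K \<subseteq> A" "A \<subseteq> (\<Union>x\<in>K. M.mball x (r / 4))"
    unfolding M.mtotally_bounded_def using r(1) by (meson divide_pos_pos zero_less_numeral)
  let ?F = "(\<lambda>x. M.mball x (r / 4)) ` K"
  show thesis
  proof
    show "finite ?F" using K by simp
    show "?F \<noteq> {}" using K Ane by auto
    show "openin (mtopology_of X) u \<and> u \<noteq> {}" if "u \<in> ?F" for u
      using that K Asub r(1) unfolding topX by fastforce
    show "C \<in> \<U>" if C: "finite C" "C \<subseteq> \<Union>?F" "\<And>u. u \<in> ?F \<Longrightarrow> C \<inter> u \<noteq> {}" for C
    proof -
      have "C \<noteq> {}" using C(3) \<open>?F \<noteq> {}\<close> by blast
      moreover have Csub: "C \<subseteq> mspace X" using C(2) by auto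
      ultimately have CH: "C \<in> hyper_carrier X" using C(1) by (intro finite_in_hyper_carrier)
      have "hausdorff_dist X A C \<le> r / 2"
      proof (rule hausdorff_dist_leI[OF AH CH])
        fix a assume "a \<in> A"
        then obtain x where x: "x \<in> K" "a \<in> M.mball x (r / 4)" using K by blast
        then obtain c where c: "c \<in> C" "c \<in> M.mball x (r / 4)" using C(3) by blast
        have "mdist X a c \<le> mdist X x a + mdist X x c"
          using x c M.triangle[of a x c] by (simp add: M.commute)
        also have "\<dots> \<le> r / 2" using x c by auto
        finally show "\<exists>c\<in>C. mdist X a c \<le> r / 2" using c(1) by blast
      next
        fix c assume "c \<in> C"
        then obtain x where "x \<in> K" "c \<in> M.mball x (r / 4)" using C(2) by blast
        then show "\<exists>a\<in>A. mdist X c a \<le> r / 2"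
          using K(2) r(1) by (intro bexI[of _ x]) (auto simp: M.commute)
      qed
      then have "C \<in> H.mball A r" using AH CH r(1) by simp
      then show ?thesis using r(2) by blast
    qed
  qed
qed


section \<open>Weak mixing of the induced action\<close>

text \<open>
  One point for each pair \<open>(u, v)\<close> suffices: as the pairs exhaust \<open>F \<times> G\<close>, the chosen points
  meet every \<open>u\<close>, and their images meet every \<open>v\<close>.
\<close>

lemma hitting_induced_action:
  assumes F: "F \<noteq> {}" "finite F"
    "\<And>C. finite C \<Longrightarrow> C \<subseteq> \<Union>F \<Longrightarrow> (\<And>u. u \<in> F \<Longrightarrow> C \<inter> u \<noteq> {}) \<Longrightarrow> C \<in> \<U>"
    and G: "G \<noteq> {}" "finite G"
    "\<And>C. finite C \<Longrightarrow> C \<subseteq> \<Union>G \<Longrightarrow> (\<And>v. v \<in> G \<Longrightarrow> C \<inter> v \<noteq> {}) \<Longrightarrow> C \<in> \<V>"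
    and m: "\<And>u v. u \<in> F \<Longrightarrow> v \<in> G \<Longrightarrow> m \<in> hitting d k T u v"
  shows "m \<in> hitting d k (induced_action T) \<U> \<V>"
proof -
  have "\<exists>x. x \<in> u \<and> T m x \<in> v" if "u \<in> F" "v \<in> G" for u v
    using m[OF that] unfolding hitting_def by blast
  then obtain x where x: "\<And>u v. u \<in> F \<Longrightarrow> v \<in> G \<Longrightarrow> x u v \<in> u \<and> T m (x u v) \<in> v"
    by metis
  define C where "C = (\<lambda>(u, v). x u v) ` (F \<times> G)"
  have fin: "finite C" unfolding C_def using F G by simp
  have mem: "x u v \<in> C" if "u \<in> F" "v \<in> G" for u v
    unfolding C_def using that by force
  have "C \<in> \<U>"
  proof (rule F(3)[OF fin])
    show "C \<subseteq> \<Union>F" unfolding C_def using x by auto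
    show "C \<inter> u \<noteq> {}" if "u \<in> F" for u using that G(1) mem x by blast
  qed
  moreover have "T m ` C \<in> \<V>"
  proof (rule G(3))
    show "finite (T m ` C)" using fin by simp
    show "T m ` C \<subseteq> \<Union>G" unfolding C_def using x by auto
    show "T m ` C \<inter> v \<noteq> {}" if "v \<in> G" for v using that F(1) mem x by blast
  qed
  moreover obtain u v where "u \<in> F" "v \<in> G" using F(1) G(1) by blast
  ultimately show ?thesis
    using m[of u v] unfolding hitting_def induced_action_def by blast
qed

lemma type_weakly_mixing_hyperspace:
  assumes cpt: "compact_space (mtopology_of X)" and T: "zaction d (mtopology_of X) T"
    and wm: "type_weakly_mixing d k (mtopology_of X) T"
  shows "type_weakly_mixing d k (mtopology_of (hyperspace X)) (induced_action T)"
  unfolding type_weakly_mixing_iff_hitting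
proof (intro allI impI, elim conjE)
  fix \<U>1 \<U>2 \<V>1 \<V>2
  assume U1: "openin (mtopology_of (hyperspace X)) \<U>1" "\<U>1 \<noteq> {}"
    and U2: "openin (mtopology_of (hyperspace X)) \<U>2" "\<U>2 \<noteq> {}"
    and V1: "openin (mtopology_of (hyperspace X)) \<V>1" "\<V>1 \<noteq> {}"
    and V2: "openin (mtopology_of (hyperspace X)) \<V>2" "\<V>2 \<noteq> {}"
  note family = hyperspace_open_finite_family[OF cpt]
  obtain F1 where F1: "finite F1" "F1 \<noteq> {}"
    "\<And>u. u \<in> F1 \<Longrightarrow> openin (mtopology_of X) u \<and> u \<noteq> {}"
    "\<And>C. finite C \<Longrightarrow> C \<subseteq> \<Union>F1 \<Longrightarrow> (\<And>u. u \<in> F1 \<Longrightarrow> C \<inter> u \<noteq> {}) \<Longrightarrow> C \<in> \<U>1"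
    using family[OF U1] by blast
  obtain F2 where F2: "finite F2" "F2 \<noteq> {}"
    "\<And>u. u \<in> F2 \<Longrightarrow> openin (mtopology_of X) u \<and> u \<noteq> {}"
    "\<And>C. finite C \<Longrightarrow> C \<subseteq> \<Union>F2 \<Longrightarrow> (\<And>u. u \<in> F2 \<Longrightarrow> C \<inter> u \<noteq> {}) \<Longrightarrow> C \<in> \<U>2"
    using family[OF U2] by blast
  obtain G1 where G1: "finite G1" "G1 \<noteq> {}"
    "\<And>u. u \<in> G1 \<Longrightarrow> openin (mtopology_of X) u \<and> u \<noteq> {}"
    "\<And>C. finite C \<Longrightarrow> C \<subseteq> \<Union>G1 \<Longrightarrow> (\<And>u. u \<in> G1 \<Longrightarrow> C \<inter> u \<noteq> {}) \<Longrightarrow> C \<in> \<V>1"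
    using family[OF V1] by blast
  obtain G2 where G2: "finite G2" "G2 \<noteq> {}"
    "\<And>u. u \<in> G2 \<Longrightarrow> openin (mtopology_of X) u \<and> u \<noteq> {}"
    "\<And>C. finite C \<Longrightarrow> C \<subseteq> \<Union>G2 \<Longrightarrow> (\<And>u. u \<in> G2 \<Longrightarrow> C \<inter> u \<noteq> {}) \<Longrightarrow> C \<in> \<V>2"
    using family[OF V2] by blast
  let ?P = "F1 \<times> G1 \<union> F2 \<times> G2"
  have "(\<Inter>(u, v)\<in>?P. hitting d k T u v) \<noteq> {}"
  proof (rule INT_hitting_nonempty[OF T wm])
    show "finite ?P" using F1(1) F2(1) G1(1) G2(1) by simp
    show "?P \<noteq> {}" using F1(2) G1(2) by simp
  qed (use F1(3) F2(3) G1(3) G2(3) in blast)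
  then obtain m where m: "\<And>u v. (u, v) \<in> ?P \<Longrightarrow> m \<in> hitting d k T u v" by fast
  have "m \<in> hitting d k (induced_action T) \<U>1 \<V>1"
    by (rule hitting_induced_action[OF F1(2,1,4) G1(2,1,4)]) (simp_all add: m)
  moreover have "m \<in> hitting d k (induced_action T) \<U>2 \<V>2"
    by (rule hitting_induced_action[OF F2(2,1,4) G2(2,1,4)]) (simp_all add: m)
  ultimately show "hitting d k (induced_action T) \<U>1 \<V>1
      \<inter> hitting d k (induced_action T) \<U>2 \<V>2 \<noteq> {}" by blast
qed

lemma hyperspace_open_below:
  assumes cpt: "compact_space (mtopology_of X)" and U: "openin (mtopology_of X) U" "U \<noteq> {}"
  obtains \<U> where "openin (mtopology_of (hyperspace X)) \<U>" "\<U> \<noteq> {}"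
    "\<And>A. A \<in> \<U> \<Longrightarrow> A \<subseteq> U \<and> A \<noteq> {}"
proof -
  interpret M: Metric_space "mspace X" "mdist X" by (rule Metric_space_mspace_mdist)
  interpret H: Metric_space "hyper_carrier X" "hausdorff_dist X"
    by (rule Metric_space_hausdorff[OF cpt])
  obtain x r where x: "x \<in> mspace X" "r > 0" "M.mball x r \<subseteq> U"
    using U unfolding mtopology_of_def M.openin_mtopology by blast
  show thesis
  proof
    show "openin (mtopology_of (hyperspace X)) (H.mball {x} r)"
      by (simp add: mtopology_of_def hyperspace_simps[OF cpt])
    have "{x} \<in> hyper_carrier X" using x(1) by (intro finite_in_hyper_carrier) auto
    then show "H.mball {x} r \<noteq> {}" using x(2) H.centre_in_mball_iff by blast
    show "A \<subseteq> U \<and> A \<noteq> {}" if "A \<in> H.mball {x} r" for A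
    proof -
      have A: "A \<in> hyper_carrier X" "hausdorff_dist X {x} A < r"
        using that by simp_all
      have "A \<subseteq> M.mball x r"
        using subset_mball_if_hausdorff_dist_less[OF cpt A(1) x(1) A(2)] by (simp add: mball_of_def)
      then show ?thesis using A(1) x(3) by (auto simp: hyper_carrier_def)
    qed
  qed
qed

lemma type_weakly_mixing_base:
  assumes cpt: "compact_space (mtopology_of X)"
    and wm: "type_weakly_mixing d k (mtopology_of (hyperspace X)) (induced_action T)"
  shows "type_weakly_mixing d k (mtopology_of X) T"
  unfolding type_weakly_mixing_iff_hitting
proof (intro allI impI, elim conjE)
  fix U1 U2 V1 V2
  assume U1: "openin (mtopology_of X) U1" "U1 \<noteq> {}" and U2: "openin (mtopology_of X) U2" "U2 \<noteq> {}"
    and V1: "openin (mtopology_of X) V1" "V1 \<noteq> {}" and V2: "openin (mtopology_of X) V2" "V2 \<noteq> {}"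
  note below = hyperspace_open_below[OF cpt]
  obtain \<U>1 where \<U>1: "openin (mtopology_of (hyperspace X)) \<U>1" "\<U>1 \<noteq> {}"
    "\<And>A. A \<in> \<U>1 \<Longrightarrow> A \<subseteq> U1 \<and> A \<noteq> {}" using below[OF U1] by blast
  obtain \<U>2 where \<U>2: "openin (mtopology_of (hyperspace X)) \<U>2" "\<U>2 \<noteq> {}"
    "\<And>A. A \<in> \<U>2 \<Longrightarrow> A \<subseteq> U2 \<and> A \<noteq> {}" using below[OF U2] by blast
  obtain \<V>1 where \<V>1: "openin (mtopology_of (hyperspace X)) \<V>1" "\<V>1 \<noteq> {}"
    "\<And>A. A \<in> \<V>1 \<Longrightarrow> A \<subseteq> V1 \<and> A \<noteq> {}" using below[OF V1] by blast
  obtain \<V>2 where \<V>2: "openin (mtopology_of (hyperspace X)) \<V>2" "\<V>2 \<noteq> {}"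
    "\<And>A. A \<in> \<V>2 \<Longrightarrow> A \<subseteq> V2 \<and> A \<noteq> {}" using below[OF V2] by blast
  obtain m where m: "m \<in> hitting d k (induced_action T) \<U>1 \<V>1"
      "m \<in> hitting d k (induced_action T) \<U>2 \<V>2"
    using wm \<U>1(1,2) \<U>2(1,2) \<V>1(1,2) \<V>2(1,2) unfolding type_weakly_mixing_iff_hitting by blast
  have descend: "m \<in> hitting d k T U V"
    if "m \<in> hitting d k (induced_action T) \<U> \<V>" "\<And>A. A \<in> \<U> \<Longrightarrow> A \<subseteq> U \<and> A \<noteq> {}"
      "\<And>A. A \<in> \<V> \<Longrightarrow> A \<subseteq> V \<and> A \<noteq> {}" for U V \<U> \<V>
  proof -
    have "induced_action T m ` \<U> \<inter> \<V> \<noteq> {}"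
      using that(1) unfolding hitting_def by simp
    then obtain A where "A \<in> \<U>" "T m ` A \<in> \<V>"
      by (auto simp: induced_action_def)
    then have "A \<subseteq> U" "A \<noteq> {}" "T m ` A \<subseteq> V" using that(2,3) by auto
    then show ?thesis using that(1) unfolding hitting_def by blast
  qed
  show "hitting d k T U1 V1 \<inter> hitting d k T U2 V2 \<noteq> {}"
    using descend[OF m(1) \<U>1(3) \<V>1(3)] descend[OF m(2) \<U>2(3) \<V>2(3)] by blast
qed

theorem theorem3p2:
  fixes X :: "'a metric" and d k :: nat and T :: "(nat \<Rightarrow> int) \<Rightarrow> 'a \<Rightarrow> 'a"
  assumes "compact_space (mtopology_of X)"
    and "d \<ge> 1"
    and "zaction d (mtopology_of X) T"
    and "k \<in> {1..2 ^ d}"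
  shows "type_weakly_mixing d k (mtopology_of X) T \<longleftrightarrow>
    type_weakly_mixing d k (mtopology_of (hyperspace X)) (induced_action T)"
  using type_weakly_mixing_hyperspace[OF assms(1,3)] type_weakly_mixing_base[OF assms(1)]
  by blast

end
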